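(* Let $A,B,C$ be a Leonard triple on $V$ that has $q$-Racah type with Huang data $(a,b,c,d)$. Then there exists an invertible $W\in\mathrm{End}(V)$ such that $A$ commutes with $W$ and with $W^{-1}BW-C$. This $W$ is unique up to multiplication by a nonzero scalar in $\mathbb F$.
   Context: Let $\mathbb F$ be a field, $d\ge 0$ an integer, $V$ a vector space over $\mathbb F$ of dimension $d+1$, $\mathrm{End}(V)$ the $\mathbb F$-algebra of $\mathbb F$-linear maps $V\to V$, and $I$ its identity. A square matrix is tridiagonal if each nonzero entry lies on the diagonal, subdiagonal or superdiagonal; a tridiagonal matrix is irreducible if every subdiagonal entry and every superdiagonal entry is nonzero. Leonard triple on $V$: a 3-tuple $A,B,C$ of elements of $\mathrm{End}(V)$ such that (i) there is a basis of $V$ with respect to which $A$ is represented by a diagonal matrix and $B,C$ by irreducible tridiagonal matrices; (ii) there is a basis with respect to which $B$ is diagonal and $C,A$ are irreducible tridiagonal; (iii) there is a basis with respect to which $C$ is diagonal and $A,B$ are irreducible tridiagonal. Each of $A,B,C$ is then diagonalizable with one-dimensional eigenspaces. An ordering of the eigenvalues of $A$ is standard if corresponding eigenvectors, in that order, form a basis as in (i); similarly for $B$ with (ii) and $C$ with (iii). Standing assumptions: fix a nonzero $q\in\mathbb F$ with $q^4\ne 1$ and nonzero $a,b,c\in\mathbb F$ such that $q^{2i}\ne 1$ for $1\le i\le d$; none of $a^2,b^2,c^2$ is among $q^{2d-2},q^{2d-4},\ldots,q^{2-2d}$; none of $abc,a^{-1}bc,ab^{-1}c,abc^{-1}$ is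 among $q^{d-1},q^{d-3},\ldots,q^{1-d}$. For $0\le i\le d$ let $\theta_i=aq^{2i-d}+a^{-1}q^{d-2i}$, $\theta'_i=bq^{2i-d}+b^{-1}q^{d-2i}$, $\theta''_i=cq^{2i-d}+c^{-1}q^{d-2i}$. A Leonard triple $A,B,C$ on $V$ has $q$-Racah type with Huang data $(a,b,c,d)$ if $\{\theta_i\}_{i=0}^d$, $\{\theta'_i\}_{i=0}^d$, $\{\theta''_i\}_{i=0}^d$ are standard orderings of the eigenvalues of $A$, $B$, $C$ respectively, and $$A+\frac{qBC-q^{-1}CB}{q^2-q^{-2}}=\alpha_a I,\quad B+\frac{qCA-q^{-1}AC}{q^2-q^{-2}}=\alpha_b I,\quad C+\frac{qAB-q^{-1}BA}{q^2-q^{-2}}=\alpha_c I,$$ where $\alpha_a=\frac{(a+a^{-1})(q^{d+1}+q^{-d-1})+(b+b^{-1})(c+c^{-1})}{q+q^{-1}}$, $\alpha_b=\frac{(b+b^{-1})(q^{d+1}+q^{-d-1})+(c+c^{-1})(a+a^{-1})}{q+q^{-1}}$, $\alpha_c=\frac{(c+c^{-1})(q^{d+1}+q^{-d-1})+(a+a^{-1})(b+b^{-1})}{q+q^{-1}}$. *)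

theory Defs
  imports Main "HOL.Vector_Spaces"
begin

context vector_space
begin

text \<open>The space V is the whole type \<open>'b\<close>. A basis is a sequence \<open>v 0, \<dots>, v d\<close>, since
  tridiagonality depends on the order of the basis vectors.\<close>

definition is_ordered_basis :: "nat \<Rightarrow> (nat \<Rightarrow> 'b) \<Rightarrow> bool" where
  "is_ordered_basis d v \<longleftrightarrow>
     inj_on v {..d} \<and> independent (v ` {..d}) \<and> span (v ` {..d}) = UNIV"

text \<open>Column convention: \<open>f (v j) = (\<Sum>i\<le>d. matrix_wrt d v f i j *s v i)\<close> for \<open>j \<le> d\<close>.\<close>

definition matrix_wrt :: "nat \<Rightarrow> (nat \<Rightarrow> 'b) \<Rightarrow> ('b \<Rightarrow> 'b) \<Rightarrow> nat \<Rightarrow> nat \<Rightarrow> 'a" where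
  "matrix_wrt d v f i j = representation (v ` {..d}) (f (v j)) (v i)"

end

text \<open>Matrices are of size \<open>d + 1\<close>, with rows and columns indexed by \<open>0, \<dots>, d\<close>.\<close>

definition diagonal :: "nat \<Rightarrow> (nat \<Rightarrow> nat \<Rightarrow> 'a::zero) \<Rightarrow> bool" where
  "diagonal d M \<longleftrightarrow> (\<forall>i\<le>d. \<forall>j\<le>d. i \<noteq> j \<longrightarrow> M i j = 0)"

definition tridiagonal :: "nat \<Rightarrow> (nat \<Rightarrow> nat \<Rightarrow> 'a::zero) \<Rightarrow> bool" where
  "tridiagonal d M \<longleftrightarrow>
     (\<forall>i\<le>d. \<forall>j\<le>d. M i j \<noteq> 0 \<longrightarrow> i = j \<or> i = Suc j \<or> j = Suc i)"

definition irreducible_tridiagonal :: "nat \<Rightarrow> (nat \<Rightarrow> nat \<Rightarrow> 'a::zero) \<Rightarrow> bool" where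
  "irreducible_tridiagonal d M \<longleftrightarrow>
     tridiagonal d M \<and> (\<forall>i<d. M (Suc i) i \<noteq> 0 \<and> M i (Suc i) \<noteq> 0)"

context vector_space
begin

definition leonard_basis ::
    "nat \<Rightarrow> (nat \<Rightarrow> 'b) \<Rightarrow> ('b \<Rightarrow> 'b) \<Rightarrow> ('b \<Rightarrow> 'b) \<Rightarrow> ('b \<Rightarrow> 'b) \<Rightarrow> bool" where
  "leonard_basis d v A B C \<longleftrightarrow>
     is_ordered_basis d v \<and>
     diagonal d (matrix_wrt d v A) \<and>
     irreducible_tridiagonal d (matrix_wrt d v B) \<and>
     irreducible_tridiagonal d (matrix_wrt d v C)"

definition leonard_triple ::
    "nat \<Rightarrow> ('b \<Rightarrow> 'b) \<Rightarrow> ('b \<Rightarrow> 'b) \<Rightarrow> ('b \<Rightarrow> 'b) \<Rightarrow> bool" where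
  "leonard_triple d A B C \<longleftrightarrow>
     Vector_Spaces.linear scale scale A \<and>
     Vector_Spaces.linear scale scale B \<and>
     Vector_Spaces.linear scale scale C \<and>
     (\<exists>v. leonard_basis d v A B C) \<and>
     (\<exists>v. leonard_basis d v B C A) \<and>
     (\<exists>v. leonard_basis d v C A B)"

definition eigenvalues :: "('b \<Rightarrow> 'b) \<Rightarrow> 'a set" where
  "eigenvalues f = {t. \<exists>x. x \<noteq> 0 \<and> f x = t *s x}"

text \<open>Standard orderings of the eigenvalues of the first of the three maps. The relation
  \<open>leonard_basis\<close> is symmetric in its last two arguments.\<close>

definition standard_ordering ::
    "nat \<Rightarrow> (nat \<Rightarrow> 'a) \<Rightarrow> ('b \<Rightarrow> 'b) \<Rightarrow> ('b \<Rightarrow> 'b) \<Rightarrow> ('b \<Rightarrow> 'b) \<Rightarrow> bool" where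
  "standard_ordering d \<theta> A B C \<longleftrightarrow>
     bij_betw \<theta> {..d} (eigenvalues A) \<and>
     (\<exists>v. (\<forall>i\<le>d. A (v i) = \<theta> i *s v i) \<and> leonard_basis d v A B C)"

end

text \<open>The exponents run over \<open>2d-2, 2d-4, \<dots>, 2-2d\<close> and over \<open>d-1, d-3, \<dots>, 1-d\<close>; both
  lists are empty for \<open>d = 0\<close>.\<close>

definition huang_data_admissible :: "'a::field \<Rightarrow> 'a \<Rightarrow> 'a \<Rightarrow> 'a \<Rightarrow> nat \<Rightarrow> bool" where
  "huang_data_admissible q a b c d \<longleftrightarrow>
     q \<noteq> 0 \<and> q ^ 4 \<noteq> 1 \<and> a \<noteq> 0 \<and> b \<noteq> 0 \<and> c \<noteq> 0 \<and>
     (\<forall>i\<in>{1..d}. q ^ (2 * i) \<noteq> 1) \<and>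
     (\<forall>x\<in>{a, b, c}. x ^ 2 \<notin> {q powi (2 * k) | k. 1 - int d \<le> k \<and> k \<le> int d - 1}) \<and>
     (\<forall>x\<in>{a * b * c, inverse a * b * c, a * inverse b * c, a * b * inverse c}.
        x \<notin> {q powi (int d - 1 - 2 * int j) | j. j < d})"

definition racah_eigenvalue :: "'a::field \<Rightarrow> nat \<Rightarrow> 'a \<Rightarrow> nat \<Rightarrow> 'a" where
  "racah_eigenvalue q d a i =
     a * q powi (2 * int i - int d) + inverse a * q powi (int d - 2 * int i)"

text \<open>\<open>racah_alpha q d a b c\<close> is \<open>\<alpha>_a\<close>; \<open>\<alpha>_b\<close> and \<open>\<alpha>_c\<close> arise by cyclic permutation of
  \<open>a, b, c\<close>.\<close>

definition racah_alpha :: "'a::field \<Rightarrow> nat \<Rightarrow> 'a \<Rightarrow> 'a \<Rightarrow> 'a \<Rightarrow> 'a" where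
  "racah_alpha q d a b c =
     ((a + inverse a) * (q powi (int d + 1) + q powi (- int d - 1))
       + (b + inverse b) * (c + inverse c)) / (q + inverse q)"

context vector_space
begin

text \<open>The relation \<open>A + (q B C - q\<^sup>-\<^sup>1 C B) / (q\<^sup>2 - q\<^sup>-\<^sup>2) = \<alpha> I\<close> in \<open>End(V)\<close>.\<close>

definition askey_wilson_relation ::
    "'a \<Rightarrow> 'a \<Rightarrow> ('b \<Rightarrow> 'b) \<Rightarrow> ('b \<Rightarrow> 'b) \<Rightarrow> ('b \<Rightarrow> 'b) \<Rightarrow> bool" where
  "askey_wilson_relation q \<alpha> A B C \<longleftrightarrow>
     (\<forall>x. A x + inverse (q powi 2 - q powi (-2)) *s (q *s B (C x) - inverse q *s C (B x))
            = \<alpha> *s x)"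

definition q_racah_type ::
    "'a \<Rightarrow> 'a \<Rightarrow> 'a \<Rightarrow> 'a \<Rightarrow> nat \<Rightarrow> ('b \<Rightarrow> 'b) \<Rightarrow> ('b \<Rightarrow> 'b) \<Rightarrow> ('b \<Rightarrow> 'b) \<Rightarrow> bool" where
  "q_racah_type q a b c d A B C \<longleftrightarrow>
     standard_ordering d (racah_eigenvalue q d a) A B C \<and>
     standard_ordering d (racah_eigenvalue q d b) B C A \<and>
     standard_ordering d (racah_eigenvalue q d c) C A B \<and>
     askey_wilson_relation q (racah_alpha q d a b c) A B C \<and>
     askey_wilson_relation q (racah_alpha q d b c a) B C A \<and>
     askey_wilson_relation q (racah_alpha q d c a b) C A B"

definition invertible_End :: "('b \<Rightarrow> 'b) \<Rightarrow> bool" where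
  "invertible_End W \<longleftrightarrow> Vector_Spaces.linear scale scale W \<and> bij W"

end

definition commute :: "('b \<Rightarrow> 'b) \<Rightarrow> ('b \<Rightarrow> 'b) \<Rightarrow> bool" where
  "commute f g \<longleftrightarrow> f \<circ> g = g \<circ> f"

end

theory Submission
  imports Defs
begin

text \<open>
  Everything happens in the matrices with respect to a basis \<open>v\<close> that realises the standard
  ordering \<open>\<theta> 0, \<dots>, \<theta> d\<close> of the eigenvalues of \<open>A\<close>. Because the \<open>\<theta> i\<close> are distinct, an endomorphism
  commutes with \<open>A\<close> exactly if its matrix is diagonal (\<open>commute_iff_diagonal\<close>). Hence \<open>W\<close> is
  \<open>diag(w 0, \<dots>, w d)\<close>, conjugation multiplies the \<open>(i, j)\<close> entry of \<open>B\<close> by \<open>w j / w i\<close>, and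
  the condition on \<open>W\<inverse> B W - C\<close> becomes \<open>B i j * w j = w i * C i j\<close> for \<open>i \<noteq> j\<close>
  (\<open>commute_conj_minus_iff\<close>).

  Uniqueness uses only the subdiagonal: there \<open>C\<close> does not vanish, so \<open>w (j + 1)\<close> is
  determined by \<open>w j\<close>, and all of \<open>W\<close> by \<open>w 0\<close>.

  Existence is the compatibility of the superdiagonal with the subdiagonal, which prescribe
  \<open>w (i + 1) / w i\<close> as \<open>C i (i+1) / B i (i+1)\<close> and as \<open>B (i+1) i / C (i+1) i\<close>. The third of the
  three defining relations expresses \<open>C\<close> by \<open>A\<close> and \<open>B\<close>, and in the basis \<open>v\<close> it says that
  \<open>(q\<^sup>2 - q\<^sup>-\<^sup>2) C i j = - (q \<theta> i - q\<^sup>-\<^sup>1 \<theta> j) B i j\<close> off the diagonal. For the eigenvalues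
  \<open>\<theta> i = t + t\<^sup>-\<^sup>1\<close> with \<open>t = a q^(2i-d)\<close> the two scalars for \<open>(i, i+1)\<close> and \<open>(i+1, i)\<close> are
  \<open>- 1/(t q)\<close> and \<open>- t q\<close>, which are inverse to each other (\<open>racah_eigenvalue_diff\<close>). So both
  prescriptions agree, and they give \<open>w i = (-1)^i a^(-i) q^(i(d-i))\<close> up to a common factor.
\<close>

section \<open>Matrices with respect to an ordered basis\<close>

context vector_space
begin

lemma representation_ordered_basis_eq:
  assumes "is_ordered_basis d v"
  shows "(\<Sum>i\<le>d. representation (v ` {..d}) x (v i) *s v i) = x"
proof -
  have "(\<Sum>b\<in>v ` {..d}. representation (v ` {..d}) x b *s b) = x"
    using assms by (intro sum_representation_eq) (auto simp: is_ordered_basis_def)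
  then show ?thesis
    using assms by (simp add: sum.reindex is_ordered_basis_def)
qed

lemma ordered_basis_eqI:
  assumes "is_ordered_basis d v"
    and "\<And>i. i \<le> d \<Longrightarrow> representation (v ` {..d}) x (v i) = representation (v ` {..d}) y (v i)"
  shows "x = y"
  using assms(2) representation_ordered_basis_eq[OF assms(1), of x]
    representation_ordered_basis_eq[OF assms(1), of y]
  by (metis (no_types, lifting) atMost_iff sum.cong)

lemma representation_ordered_basis_self:
  assumes "is_ordered_basis d v" "i \<le> d" "j \<le> d"
  shows "representation (v ` {..d}) (v j) (v i) = (if i = j then 1 else 0)"
  using assms by (auto simp: is_ordered_basis_def representation_basis inj_on_eq_iff)

lemma representation_ordered_basis_linear:
  assumes "is_ordered_basis d v"
  shows "representation (v ` {..d}) (x + y) b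
           = representation (v ` {..d}) x b + representation (v ` {..d}) y b"
    and "representation (v ` {..d}) (x - y) b
           = representation (v ` {..d}) x b - representation (v ` {..d}) y b"
    and "representation (v ` {..d}) (r *s x) b = r * representation (v ` {..d}) x b"
  using assms
  by (auto simp: is_ordered_basis_def representation_add representation_diff representation_scale)

lemma ordered_basis_linear_eqI:
  assumes v: "is_ordered_basis d v"
    and f: "Vector_Spaces.linear scale scale f" and g: "Vector_Spaces.linear scale scale g"
    and eq: "\<And>i. i \<le> d \<Longrightarrow> f (v i) = g (v i)"
  shows "f = g"
proof
  fix x
  interpret f: Vector_Spaces.linear scale scale f by (rule f)
  interpret g: Vector_Spaces.linear scale scale g by (rule g)
  let ?r = "\<lambda>i. representation (v ` {..d}) x (v i)"
  have "f (\<Sum>i\<le>d. ?r i *s v i) = g (\<Sum>i\<le>d. ?r i *s v i)"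
    by (simp add: f.sum g.sum f.scale g.scale eq)
  then show "f x = g x"
    by (simp add: representation_ordered_basis_eq[OF v])
qed

lemma diagonal_matrix_wrt_iff:
  assumes v: "is_ordered_basis d v"
  shows "diagonal d (matrix_wrt d v f) \<longleftrightarrow> (\<forall>j\<le>d. f (v j) = matrix_wrt d v f j j *s v j)"
proof
  assume diag: "diagonal d (matrix_wrt d v f)"
  show "\<forall>j\<le>d. f (v j) = matrix_wrt d v f j j *s v j"
  proof (intro allI impI)
    fix j assume "j \<le> d"
    with diag v show "f (v j) = matrix_wrt d v f j j *s v j"
      by (intro ordered_basis_eqI[OF v])
        (auto simp: representation_ordered_basis_linear representation_ordered_basis_self
          diagonal_def matrix_wrt_def)
  qed
next
  assume f: "\<forall>j\<le>d. f (v j) = matrix_wrt d v f j j *s v j"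
  show "diagonal d (matrix_wrt d v f)"
    unfolding diagonal_def
  proof (intro allI impI)
    fix i j assume "i \<le> d" "j \<le> d" "i \<noteq> j"
    then have "representation (v ` {..d}) (matrix_wrt d v f j j *s v j) (v i) = 0"
      using v by (simp add: representation_ordered_basis_linear representation_ordered_basis_self)
    then show "matrix_wrt d v f i j = 0"
      using f \<open>j \<le> d\<close> by (metis matrix_wrt_def)
  qed
qed

lemma representation_eigenbasis_apply:
  assumes v: "is_ordered_basis d v"
    and f: "Vector_Spaces.linear scale scale f"
    and eig: "\<And>i. i \<le> d \<Longrightarrow> f (v i) = t i *s v i"
    and i: "i \<le> d"
  shows "representation (v ` {..d}) (f x) (v i) = t i * representation (v ` {..d}) x (v i)"
proof -
  interpret f: Vector_Spaces.linear scale scale f by (rule f)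
  let ?R = "representation (v ` {..d})"
  have "f x = f (\<Sum>j\<le>d. ?R x (v j) *s v j)"
    by (simp add: representation_ordered_basis_eq[OF v])
  also have "\<dots> = (\<Sum>j\<le>d. (?R x (v j) * t j) *s v j)"
    by (simp add: f.sum f.scale eig)
  finally have "?R (f x) (v i) = (\<Sum>j\<le>d. ?R ((?R x (v j) * t j) *s v j) (v i))"
    using v by (simp add: representation_sum is_ordered_basis_def)
  also have "\<dots> = (\<Sum>j\<le>d. if i = j then ?R x (v j) * t j else 0)"
    using v i by (intro sum.cong)
      (auto simp: representation_ordered_basis_linear representation_ordered_basis_self)
  also have "\<dots> = t i * ?R x (v i)"
    using i by (simp add: mult.commute)
  finally show ?thesis .
qed

lemma diagonal_linear_map_exists:
  assumes v: "is_ordered_basis d v"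
  obtains f where "Vector_Spaces.linear scale scale f" "\<And>i. i \<le> d \<Longrightarrow> f (v i) = t i *s v i"
proof -
  define f where "f x = (\<Sum>i\<le>d. (t i * representation (v ` {..d}) x (v i)) *s v i)" for x
  have "Vector_Spaces.linear scale scale f"
    by (unfold_locales)
      (simp_all add: f_def representation_ordered_basis_linear[OF v] algebra_simps
        sum.distrib scale_sum_right)
  moreover have "f (v j) = t j *s v j" if "j \<le> d" for j
  proof -
    have "f (v j) = (\<Sum>i\<le>d. if i = j then t j *s v j else 0)"
      unfolding f_def using that
      by (intro sum.cong) (auto simp: representation_ordered_basis_self[OF v])
    then show ?thesis using that by simp
  qed
  ultimately show ?thesis using that by blast
qed

lemma diagonal_map_invertible:
  assumes v: "is_ordered_basis d v"
    and f: "Vector_Spaces.linear scale scale f"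
    and eig: "\<And>i. i \<le> d \<Longrightarrow> f (v i) = t i *s v i"
    and nz: "\<And>i. i \<le> d \<Longrightarrow> t i \<noteq> 0"
  shows "invertible_End f"
proof -
  obtain g where g: "Vector_Spaces.linear scale scale g"
    and geig: "\<And>i. i \<le> d \<Longrightarrow> g (v i) = inverse (t i) *s v i"
    using diagonal_linear_map_exists[OF v, of "\<lambda>i. inverse (t i)"] by blast
  have "g (f x) = x" for x
    by (rule ordered_basis_eqI[OF v])
      (simp add: representation_eigenbasis_apply[OF v g geig]
        representation_eigenbasis_apply[OF v f eig] nz)
  moreover have "f (g x) = x" for x
    by (rule ordered_basis_eqI[OF v])
      (simp add: representation_eigenbasis_apply[OF v g geig]
        representation_eigenbasis_apply[OF v f eig] nz)
  ultimately have "bij f"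
    by (metis bijI')
  with f show ?thesis by (simp add: invertible_End_def)
qed

section \<open>The commutant of a multiplicity-free map\<close>

text \<open>Comparing the \<open>(i, j)\<close> entries of \<open>A f\<close> and \<open>f A\<close> gives \<open>(\<theta> i - \<theta> j) f i j = 0\<close>.\<close>

lemma commute_iff_diagonal:
  assumes v: "is_ordered_basis d v"
    and A: "Vector_Spaces.linear scale scale A"
    and f: "Vector_Spaces.linear scale scale f"
    and eig: "\<And>i. i \<le> d \<Longrightarrow> A (v i) = \<theta> i *s v i"
    and inj: "inj_on \<theta> {..d}"
  shows "commute A f \<longleftrightarrow> diagonal d (matrix_wrt d v f)"
proof
  interpret f: Vector_Spaces.linear scale scale f by (rule f)
  assume com: "commute A f"
  show "diagonal d (matrix_wrt d v f)"
    unfolding diagonal_def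
  proof (intro allI impI)
    fix i j assume ij: "i \<le> d" "j \<le> d" "i \<noteq> j"
    have "A (f (v j)) = \<theta> j *s f (v j)"
      using com ij by (metis commute_def comp_apply eig f.scale)
    then have "\<theta> i * matrix_wrt d v f i j = \<theta> j * matrix_wrt d v f i j"
      using representation_eigenbasis_apply[OF v A eig ij(1), of "f (v j)"]
      by (metis matrix_wrt_def representation_ordered_basis_linear(3)[OF v])
    moreover have "\<theta> i \<noteq> \<theta> j"
      using inj ij by (auto simp: inj_on_eq_iff)
    ultimately show "matrix_wrt d v f i j = 0" by simp
  qed
next
  interpret A: Vector_Spaces.linear scale scale A by (rule A)
  interpret f: Vector_Spaces.linear scale scale f by (rule f)
  assume "diagonal d (matrix_wrt d v f)"
  then have feig: "\<And>j. j \<le> d \<Longrightarrow> f (v j) = matrix_wrt d v f j j *s v j"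
    using diagonal_matrix_wrt_iff[OF v] by blast
  have "A (f x) = f (A x)" for x
    by (rule ordered_basis_eqI[OF v])
      (simp add: representation_eigenbasis_apply[OF v A eig]
        representation_eigenbasis_apply[OF v f feig])
  then show "commute A f" by (auto simp: commute_def)
qed

text \<open>The \<open>(i, j)\<close> entry of \<open>W\<inverse> B W - C\<close> is \<open>w i\<inverse> * B i j * w j - C i j\<close>.\<close>

lemma commute_conj_minus_iff:
  assumes v: "is_ordered_basis d v"
    and A: "Vector_Spaces.linear scale scale A"
    and B: "Vector_Spaces.linear scale scale B"
    and C: "Vector_Spaces.linear scale scale C"
    and eig: "\<And>i. i \<le> d \<Longrightarrow> A (v i) = \<theta> i *s v i"
    and inj: "inj_on \<theta> {..d}"
    and W: "invertible_End W"
    and Weig: "\<And>i. i \<le> d \<Longrightarrow> W (v i) = w i *s v i"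
  shows "commute A (\<lambda>x. (inv W \<circ> B \<circ> W) x - C x) \<longleftrightarrow>
    (\<forall>i\<le>d. \<forall>j\<le>d. i \<noteq> j \<longrightarrow> matrix_wrt d v B i j * w j = w i * matrix_wrt d v C i j)"
proof -
  interpret B: Vector_Spaces.linear scale scale B by (rule B)
  interpret C: Vector_Spaces.linear scale scale C by (rule C)
  have Wl: "Vector_Spaces.linear scale scale W" and bij: "bij W"
    using W by (auto simp: invertible_End_def)
  interpret W: Vector_Spaces.linear scale scale W by (rule Wl)
  have inv: "W (inv W x) = x" "inv W (W x) = x" for x
    using bij by (simp_all add: bij_is_surj surj_f_inv_f bij_is_inj)
  have add: "inv W (x + y) = inv W x + inv W y" for x y
    by (metis W.add inv)
  have scale: "inv W (r *s x) = r *s inv W x" for r x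
    by (metis W.scale inv)
  define f where "f = (\<lambda>x. (inv W \<circ> B \<circ> W) x - C x)"
  have f: "Vector_Spaces.linear scale scale f"
    by unfold_locales
      (simp_all add: f_def add scale W.add W.scale B.add B.scale C.add C.scale algebra_simps)
  (* Multiplying by W from the left avoids the matrix of its inverse. *)
  have entry: "w i * matrix_wrt d v f i j
      = matrix_wrt d v B i j * w j - w i * matrix_wrt d v C i j"
    if "i \<le> d" "j \<le> d" for i j
  proof -
    have "W (f (v j)) = w j *s B (v j) - W (C (v j))"
      using that by (simp add: f_def W.diff inv Weig B.scale)
    then show ?thesis
      using representation_eigenbasis_apply[OF v Wl Weig that(1), of "f (v j)"]
        representation_eigenbasis_apply[OF v Wl Weig that(1), of "C (v j)"]
      by (simp add: matrix_wrt_def representation_ordered_basis_linear[OF v] mult.commute)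
  qed
  have nz: "w i \<noteq> 0" if "i \<le> d" for i
  proof
    assume "w i = 0"
    then have "W (v i) = W 0" using that by (simp add: Weig W.zero)
    then have "v i = 0" by (metis inv(2))
    with v that show False
      by (metis atMost_iff dependent_zero image_eqI is_ordered_basis_def)
  qed
  have "commute A f \<longleftrightarrow> diagonal d (matrix_wrt d v f)"
    by (rule commute_iff_diagonal[OF v A f eig inj])
  also have "\<dots> \<longleftrightarrow>
    (\<forall>i\<le>d. \<forall>j\<le>d. i \<noteq> j \<longrightarrow> matrix_wrt d v B i j * w j = w i * matrix_wrt d v C i j)"
    unfolding diagonal_def using entry nz
    by (metis (no_types, lifting) eq_iff_diff_eq_0 mult_eq_0_iff)
  finally show ?thesis by (simp add: f_def)
qed

text \<open>On the subdiagonal the condition of \<open>commute_conj_minus_iff\<close> is a first-order recurrence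
  for \<open>w\<close>, so two solutions are proportional, with factor \<open>w' 0 / w 0\<close>.\<close>

lemma commute_conj_minus_unique:
  assumes v: "is_ordered_basis d v"
    and A: "Vector_Spaces.linear scale scale A"
    and B: "Vector_Spaces.linear scale scale B"
    and C: "Vector_Spaces.linear scale scale C"
    and eig: "\<And>i. i \<le> d \<Longrightarrow> A (v i) = \<theta> i *s v i"
    and inj: "inj_on \<theta> {..d}"
    and sub: "\<And>i. i < d \<Longrightarrow> matrix_wrt d v C (Suc i) i \<noteq> 0"
    and W: "invertible_End W" "commute A W" "commute A (\<lambda>x. (inv W \<circ> B \<circ> W) x - C x)"
    and W': "invertible_End W'" "commute A W'" "commute A (\<lambda>x. (inv W' \<circ> B \<circ> W') x - C x)"
  shows "\<exists>k. k \<noteq> 0 \<and> W' = (\<lambda>x. k *s W x)"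
proof -
  have lin: "Vector_Spaces.linear scale scale W" "Vector_Spaces.linear scale scale W'"
    and bij: "bij W" "bij W'"
    using W W' by (auto simp: invertible_End_def)
  interpret W: Vector_Spaces.linear scale scale W by (rule lin)
  interpret W': Vector_Spaces.linear scale scale W' by (rule lin)
  define w where "w i = matrix_wrt d v W i i" for i
  define w' where "w' i = matrix_wrt d v W' i i" for i
  have Weig: "W (v i) = w i *s v i" and Weig': "W' (v i) = w' i *s v i" if "i \<le> d" for i
    using that W(2) W'(2) commute_iff_diagonal[OF v A _ eig inj] diagonal_matrix_wrt_iff[OF v] lin
    by (simp_all add: w_def w'_def)
  have rec: "matrix_wrt d v B (Suc i) i * w i = w (Suc i) * matrix_wrt d v C (Suc i) i"
    "matrix_wrt d v B (Suc i) i * w' i = w' (Suc i) * matrix_wrt d v C (Suc i) i"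
    if "i < d" for i
    using that W(3) W'(3) commute_conj_minus_iff[OF v A B C eig inj W(1) Weig]
      commute_conj_minus_iff[OF v A B C eig inj W'(1) Weig'] by auto
  have v0: "v 0 \<noteq> 0"
    using v by (metis atMost_iff dependent_zero image_eqI is_ordered_basis_def zero_le)
  have w0: "w 0 \<noteq> 0" and w0': "w' 0 \<noteq> 0"
    using v0 Weig[of 0] Weig'[of 0] bij W.zero W'.zero
    by (metis bij_pointE scale_zero_left zero_le)+
  define k where "k = w' 0 / w 0"
  have ratio: "w' i = k * w i" if "i \<le> d" for i
    using that
  proof (induction i)
    case 0
    then show ?case using w0 by (simp add: k_def)
  next
    case (Suc i)
    have "w' (Suc i) * matrix_wrt d v C (Suc i) i = (k * w (Suc i)) * matrix_wrt d v C (Suc i) i"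
      using Suc rec[of i] by (metis Suc_le_lessD Suc_leD mult.assoc mult.left_commute)
    with sub[of i] Suc.prems show ?case by simp
  qed
  have "W' = (\<lambda>x. k *s W x)"
  proof (rule ordered_basis_linear_eqI[OF v lin(2)])
    show "Vector_Spaces.linear scale scale (\<lambda>x. k *s W x)"
      by unfold_locales (simp_all add: W.add W.scale algebra_simps)
  qed (simp add: Weig Weig' ratio)
  moreover have "k \<noteq> 0" using w0 w0' by (simp add: k_def)
  ultimately show ?thesis by blast
qed

section \<open>The Askey-Wilson relation in an eigenbasis\<close>

text \<open>The \<open>(i, j)\<close> entries of \<open>A B\<close> and \<open>B A\<close> are \<open>\<theta> i * B i j\<close> and \<open>\<theta> j * B i j\<close>, and the
  right-hand side \<open>\<alpha> I\<close> contributes to the diagonal only.\<close>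

lemma askey_wilson_relation_entry:
  assumes v: "is_ordered_basis d v"
    and A: "Vector_Spaces.linear scale scale A"
    and B: "Vector_Spaces.linear scale scale B"
    and eig: "\<And>i. i \<le> d \<Longrightarrow> A (v i) = \<theta> i *s v i"
    and rel: "askey_wilson_relation q \<alpha> C A B"
    and ij: "i \<le> d" "j \<le> d" "i \<noteq> j"
  shows "matrix_wrt d v C i j
    = - (inverse (q powi 2 - q powi (-2)) * (q * \<theta> i - inverse q * \<theta> j) * matrix_wrt d v B i j)"
proof -
  interpret B: Vector_Spaces.linear scale scale B by (rule B)
  let ?R = "representation (v ` {..d})"
  let ?s = "inverse (q powi 2 - q powi (-2))"
  have "C (v j) + ?s *s (q *s A (B (v j)) - inverse q *s (\<theta> j *s B (v j))) = \<alpha> *s v j"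
    using rel ij by (metis askey_wilson_relation_def eig B.scale)
  then have "?R (C (v j) + ?s *s (q *s A (B (v j)) - inverse q *s (\<theta> j *s B (v j)))) (v i) = 0"
    using ij by (simp add: representation_ordered_basis_linear[OF v]
      representation_ordered_basis_self[OF v])
  then have "matrix_wrt d v C i j
      + ?s * (q * (\<theta> i * matrix_wrt d v B i j) - inverse q * (\<theta> j * matrix_wrt d v B i j)) = 0"
    by (simp only: representation_ordered_basis_linear[OF v]
      representation_eigenbasis_apply[OF v A eig ij(1)] matrix_wrt_def)
  then show ?thesis
    by (simp add: algebra_simps eq_neg_iff_add_eq_0)
qed

end

text \<open>Put \<open>t = a q^(2i-d)\<close>, so \<open>\<theta> i = t + t\<^sup>-\<^sup>1\<close> and \<open>\<theta> (i+1) = q\<^sup>2 t + q\<^sup>-\<^sup>2 t\<^sup>-\<^sup>1\<close>. In the first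
  combination the terms in \<open>t\<close> cancel, in the second one those in \<open>t\<^sup>-\<^sup>1\<close>.\<close>

lemma racah_eigenvalue_diff:
  fixes q a :: "'a::field" and d :: nat
  assumes q: "q \<noteq> 0" and a: "a \<noteq> 0"
  defines "t \<equiv> \<lambda>i. a * q powi (2 * int i - int d)"
  shows "q * racah_eigenvalue q d a i - inverse q * racah_eigenvalue q d a (Suc i)
           = (q powi 2 - q powi (-2)) * inverse (q * t i)"
    and "q * racah_eigenvalue q d a (Suc i) - inverse q * racah_eigenvalue q d a i
           = (q powi 2 - q powi (-2)) * (q * t i)"
proof -
  have t: "t i \<noteq> 0" using q a by (simp add: t_def)
  have inv: "inverse a * q powi (int d - 2 * int i) = inverse (t i)" for i
    by (simp add: t_def flip: power_int_minus)
  have "q powi (2 * int (Suc i) - int d) = q powi (2 + (2 * int i - int d))"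
    by (simp add: algebra_simps)
  also have "\<dots> = q ^ 2 * q powi (2 * int i - int d)"
    using q by (subst power_int_add) simp_all
  finally have Suc: "t (Suc i) = q ^ 2 * t i"
    by (simp add: t_def)
  have th: "racah_eigenvalue q d a j = t j + inverse (t j)" for j
    unfolding racah_eigenvalue_def inv by (simp add: t_def)
  have sq: "q powi 2 = q ^ 2" "q powi (-2) = inverse (q ^ 2)"
    by (simp_all add: power_int_minus)
  show "q * racah_eigenvalue q d a i - inverse q * racah_eigenvalue q d a (Suc i)
           = (q powi 2 - q powi (-2)) * inverse (q * t i)"
    "q * racah_eigenvalue q d a (Suc i) - inverse q * racah_eigenvalue q d a i
           = (q powi 2 - q powi (-2)) * (q * t i)"
    unfolding th Suc sq using q t by (simp_all add: field_simps power2_eq_square)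
qed

section \<open>Leonard triples of \<open>q\<close>-Racah type\<close>

theorem theorem7p6:
  fixes scale :: "'f::field \<Rightarrow> 'v::ab_group_add \<Rightarrow> 'v"
    and d :: nat
    and q a b c :: 'f
    and A B C :: "'v \<Rightarrow> 'v"
  assumes "vector_space scale"
    and "vector_space.dim scale (UNIV :: 'v set) = d + 1"
    and "huang_data_admissible q a b c d"
    and "vector_space.leonard_triple scale d A B C"
    and "vector_space.q_racah_type scale q a b c d A B C"
  shows "(\<exists>W. vector_space.invertible_End scale W \<and> commute A W \<and>
              commute A (\<lambda>x. (inv W \<circ> B \<circ> W) x - C x)) \<and>
         (\<forall>W W'. vector_space.invertible_End scale W \<and> commute A W \<and>
                 commute A (\<lambda>x. (inv W \<circ> B \<circ> W) x - C x) \<and>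
                 vector_space.invertible_End scale W' \<and> commute A W' \<and>
                 commute A (\<lambda>x. (inv W' \<circ> B \<circ> W') x - C x)
                 \<longrightarrow> (\<exists>k. k \<noteq> 0 \<and> W' = (\<lambda>x. scale k (W x))))"
proof -
  interpret vector_space scale by (rule assms(1))
  have A: "Vector_Spaces.linear scale scale A" and B: "Vector_Spaces.linear scale scale B"
    and C: "Vector_Spaces.linear scale scale C"
    using assms(4) by (auto simp: leonard_triple_def)
  have q: "q \<noteq> 0" and q4: "q ^ 4 \<noteq> 1" and a: "a \<noteq> 0"
    using assms(3) by (auto simp: huang_data_admissible_def)
  define \<theta> where "\<theta> = racah_eigenvalue q d a"
  have so: "standard_ordering d \<theta> A B C"
    and rel: "askey_wilson_relation q (racah_alpha q d c a b) C A B"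
    using assms(5) by (auto simp: q_racah_type_def \<theta>_def)
  have inj: "inj_on \<theta> {..d}"
    using so by (auto simp: standard_ordering_def bij_betw_def)
  obtain v where eig: "\<And>i. i \<le> d \<Longrightarrow> A (v i) = scale (\<theta> i) (v i)"
    and lb: "leonard_basis d v A B C"
    using so by (auto simp: standard_ordering_def)
  have v: "is_ordered_basis d v"
    and tri: "tridiagonal d (matrix_wrt d v B)"
    and sub: "\<And>i. i < d \<Longrightarrow> matrix_wrt d v C (Suc i) i \<noteq> 0"
    using lb by (auto simp: leonard_basis_def irreducible_tridiagonal_def)
  have s: "q powi 2 - q powi (-2) \<noteq> 0"
    using q q4 by (simp add: power_int_minus field_simps flip: power_add)
  (* r i is the value that the superdiagonal prescribes for w (i + 1) / w i; the entries below
     the diagonal turn out to prescribe the same value. *)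
  define r where "r i = - inverse (q * (a * q powi (2 * int i - int d)))" for i
  have r: "r i \<noteq> 0" for i using q a by (simp add: r_def)
  have up: "matrix_wrt d v C i (Suc i) = r i * matrix_wrt d v B i (Suc i)" if "i < d" for i
    using that s
    by (simp add: askey_wilson_relation_entry[OF v A B eig rel] \<theta>_def
      racah_eigenvalue_diff[OF q a] r_def)
  have low: "matrix_wrt d v C (Suc i) i = inverse (r i) * matrix_wrt d v B (Suc i) i"
    if "i < d" for i
    using that s
    by (simp add: askey_wilson_relation_entry[OF v A B eig rel] \<theta>_def
      racah_eigenvalue_diff[OF q a] r_def)
  define w where "w i = (\<Prod>k<i. r k)" for i
  have w: "w i \<noteq> 0" for i by (simp add: w_def r)
  obtain W where W: "Vector_Spaces.linear scale scale W"
    and Weig: "\<And>i. i \<le> d \<Longrightarrow> W (v i) = scale (w i) (v i)"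
    using diagonal_linear_map_exists[OF v, of w] by blast
  have Winv: "invertible_End W"
    by (rule diagonal_map_invertible[OF v W Weig w])
  have "diagonal d (matrix_wrt d v W)"
    by (simp add: diagonal_def matrix_wrt_def Weig representation_ordered_basis_linear[OF v]
      representation_ordered_basis_self[OF v])
  then have "commute A W"
    using commute_iff_diagonal[OF v A W eig inj] by blast
  moreover have "matrix_wrt d v B i j * w j = w i * matrix_wrt d v C i j"
    if ij: "i \<le> d" "j \<le> d" "i \<noteq> j" for i j
  proof -
    consider "j = Suc i" | "i = Suc j" | "matrix_wrt d v B i j = 0"
      using tri ij by (auto simp: tridiagonal_def)
    then show ?thesis
    proof cases
      case 1
      then show ?thesis using up[of i] ij by (simp add: w_def)
    next
      case 2
      then show ?thesis using low[of j] ij r[of j] by (simp add: w_def)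
    next
      case 3
      then show ?thesis using askey_wilson_relation_entry[OF v A B eig rel ij] by simp
    qed
  qed
  then have "commute A (\<lambda>x. (inv W \<circ> B \<circ> W) x - C x)"
    using commute_conj_minus_iff[OF v A B C eig inj Winv Weig] by blast
  ultimately show ?thesis
    using Winv commute_conj_minus_unique[OF v A B C eig inj sub] by blast
qed

end
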